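(* Let $G$ be a graph and let $X\subseteq V(G)$ be a potential maximal clique in $G$. Then $X$ is either a clique in $G$ or there exist two minimal separators $S$ and $T$ in $G$ such that $X\subseteq S\cup T$.
   Context: All graphs are finite, simple and undirected. A graph is chordal if it has no induced cycles of length at least four. A triangulation of $G=(V,E)$ is a chordal graph of the form $(V,E\cup F)$ where $F$ is a subset of the set of non-edges of $G$; it is a minimal triangulation if $G$ has no triangulation $(V,E\cup F')$ with $F'\subsetneq F$. A potential maximal clique in $G$ is a set $X\subseteq V(G)$ that is a maximal clique in some minimal triangulation of $G$. For non-adjacent vertices $u,v$, a $u{,}v$-separator is a set $S\subseteq V(G)\setminus\{u,v\}$ such that $u$ and $v$ lie in different components of $G-S$; it is minimal if no proper subset of it is a $u{,}v$-separator. A minimal separator in $G$ is a set $S\subseteq V(G)$ that is a minimal $u{,}v$-separator for some pair of non-adjacent vertices $u,v$. *)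

theory Defs
  imports "Graph_Theory.Digraph_Component"
begin

text \<open>
  A finite simple undirected graph is a \<^locale>\<open>pair_graph\<close>: an edge uv is represented by the
  two arcs (u,v) and (v,u).
\<close>

definition cycle_graph :: "('a \<times> 'a) awalk \<Rightarrow> 'a pair_pre_digraph" where
  "cycle_graph p = \<lparr> pverts = fst ` set p, parcs = set p \<union> (set p)\<inverse> \<rparr>"

text \<open>
  The library's cycles of a symmetric digraph include the walks u, v, u of length two, which are
  not cycles of the undirected graph; hence the lower bound on the length.
\<close>

definition induced_cycle :: "'a pair_pre_digraph \<Rightarrow> ('a \<times> 'a) awalk \<Rightarrow> bool" where
  "induced_cycle G p \<longleftrightarrow> pre_digraph.cycle (with_proj G) p \<and> 3 \<le> length p \<and>
     induced_subgraph (with_proj (cycle_graph p)) (with_proj G)"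

definition chordal :: "'a pair_pre_digraph \<Rightarrow> bool" where
  "chordal G \<longleftrightarrow> \<not> (\<exists>p. induced_cycle G p \<and> 4 \<le> length p)"

definition nonedges :: "'a pair_pre_digraph \<Rightarrow> 'a rel" where
  "nonedges G = {(u, v). u \<in> pverts G \<and> v \<in> pverts G \<and> u \<noteq> v \<and> (u, v) \<notin> parcs G}"

definition add_edges :: "'a pair_pre_digraph \<Rightarrow> 'a rel \<Rightarrow> 'a pair_pre_digraph" where
  "add_edges G F = \<lparr> pverts = pverts G, parcs = parcs G \<union> F \<rparr>"

text \<open>
  A set of undirected non-edges is a symmetric subset of \<^const>\<open>nonedges\<close>, in line with the
  representation of edges.
\<close>

definition triangulation :: "'a pair_pre_digraph \<Rightarrow> 'a rel \<Rightarrow> bool" where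
  "triangulation G F \<longleftrightarrow> F \<subseteq> nonedges G \<and> sym F \<and> chordal (add_edges G F)"

definition minimal_triangulation :: "'a pair_pre_digraph \<Rightarrow> 'a rel \<Rightarrow> bool" where
  "minimal_triangulation G F \<longleftrightarrow> triangulation G F \<and> \<not> (\<exists>F'. F' \<subset> F \<and> triangulation G F')"

definition clique :: "'a pair_pre_digraph \<Rightarrow> 'a set \<Rightarrow> bool" where
  "clique G X \<longleftrightarrow> X \<subseteq> pverts G \<and> (\<forall>u\<in>X. \<forall>v\<in>X. u \<noteq> v \<longrightarrow> (u, v) \<in> parcs G)"

definition maximal_clique :: "'a pair_pre_digraph \<Rightarrow> 'a set \<Rightarrow> bool" where
  "maximal_clique G X \<longleftrightarrow> clique G X \<and> \<not> (\<exists>Y. X \<subset> Y \<and> clique G Y)"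

definition potential_maximal_clique :: "'a pair_pre_digraph \<Rightarrow> 'a set \<Rightarrow> bool" where
  "potential_maximal_clique G X \<longleftrightarrow>
     (\<exists>F. minimal_triangulation G F \<and> maximal_clique (add_edges G F) X)"

text \<open>
  As graphs are symmetric digraphs, the components of G - S are its strongly connected components;
  \<^const>\<open>pre_digraph.sccs_verts\<close> yields their vertex sets.
\<close>

definition separator :: "'a pair_pre_digraph \<Rightarrow> 'a \<Rightarrow> 'a \<Rightarrow> 'a set \<Rightarrow> bool" where
  "separator G u v S \<longleftrightarrow> S \<subseteq> pverts G - {u, v} \<and>
     (\<exists>C \<in> pre_digraph.sccs_verts (with_proj G \<restriction> (pverts G - S)).
      \<exists>D \<in> pre_digraph.sccs_verts (with_proj G \<restriction> (pverts G - S)).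
        C \<noteq> D \<and> u \<in> C \<and> v \<in> D)"

definition minimal_pair_separator :: "'a pair_pre_digraph \<Rightarrow> 'a \<Rightarrow> 'a \<Rightarrow> 'a set \<Rightarrow> bool" where
  "minimal_pair_separator G u v S \<longleftrightarrow>
     separator G u v S \<and> \<not> (\<exists>S'. S' \<subset> S \<and> separator G u v S')"

definition minimal_separator :: "'a pair_pre_digraph \<Rightarrow> 'a set \<Rightarrow> bool" where
  "minimal_separator G S \<longleftrightarrow> (\<exists>(u, v) \<in> nonedges G. minimal_pair_separator G u v S)"

end

theory Submission
  imports Defs
begin

text \<open>
  Let \<open>H\<close> be a minimal triangulation of \<open>G\<close> in which \<open>X\<close> is a maximal clique. No component \<open>C\<close> of
  \<open>G - X\<close> satisfies \<open>X \<subseteq> N(C)\<close>, as some vertex of \<open>C\<close> would be adjacent in \<open>H\<close> to all of \<open>X\<close>.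
  Any two vertices \<open>u, v\<close> of \<open>X\<close> that are not adjacent in \<open>G\<close> lie in a common \<open>N(C)\<close>: since \<open>H - uv\<close>
  has a chordless cycle, it has one of the form \<open>u a v b\<close>, with, say, \<open>a \<notin> X\<close>, and the edges of \<open>H\<close>
  leaving the component \<open>C\<close> of \<open>a\<close> all end in \<open>N(C)\<close>, because deleting those that do not keeps \<open>H\<close>
  chordal.

  If \<open>X\<close> is not a clique in \<open>G\<close>, choose a minimal family of components whose neighbourhoods cover all
  non-adjacent pairs in \<open>X\<close>, a member \<open>C\<close> of it, and a pair \<open>u, v\<close> covered by \<open>C\<close> only. Then
  \<open>S = N(C)\<close> is a minimal separator. Deleting everything except \<open>u\<close>, \<open>v\<close> and the other members of the
  family separates \<open>u\<close> from \<open>v\<close>. A minimal separator \<open>T\<close> contained in the deleted set must contain every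
  \<open>x \<in> X - S\<close>, since \<open>x\<close> is adjacent to each of \<open>u\<close> and \<open>v\<close>, directly or through another member
  of the family.
\<close>

section \<open>Chordless cycles indexed modulo their length\<close>

text \<open>
  A chordless cycle of length \<open>n\<close> is indexed by the integers modulo \<open>n\<close>, so that it can be rotated
  and reflected by substitution.
\<close>

definition hole :: "'a rel \<Rightarrow> int \<Rightarrow> (int \<Rightarrow> 'a) \<Rightarrow> bool" where
  "hole E n f \<longleftrightarrow> 4 \<le> n \<and> (\<forall>i j. f i = f j \<longleftrightarrow> n dvd i - j) \<and>
     (\<forall>i j. (f i, f j) \<in> E \<longleftrightarrow> n dvd i - j - 1 \<or> n dvd i - j + 1)"

lemma dvd_iff_of_bounds:
  fixes n d :: int
  assumes "- n < d" "d < n"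
  shows "n dvd d \<longleftrightarrow> d = 0"
proof
  assume "n dvd d"
  then have "d \<noteq> 0 \<Longrightarrow> \<bar>n\<bar> \<le> \<bar>d\<bar>"
    by (rule dvd_imp_le_int[rotated])
  then show "d = 0" using assms by (cases "d = 0") auto
qed auto

text \<open>Since \<open>a - b - 1\<close> lies between \<open>- n\<close> and \<open>n - 2\<close>,
  the only multiples of \<open>n\<close> it can equal are \<open>0\<close> and the wrap-around value
  \<open>- n\<close>.\<close>

lemma dvd_pred_iff:
  fixes a b n :: int
  assumes "0 \<le> a" "a < n" "0 \<le> b" "b < n" "2 \<le> n"
  shows "n dvd a - b - 1 \<longleftrightarrow> a = b + 1 \<or> (a = 0 \<and> b = n - 1)"
proof (cases "a - b - 1 = - n")
  case False
  then show ?thesis using assms dvd_iff_of_bounds[of n "a - b - 1"] by auto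
qed (use assms in auto)

lemma dvd_diff_add_one_iff:
  fixes n x y :: int
  shows "n dvd x - y + 1 \<longleftrightarrow> n dvd y - x - 1"
  using dvd_minus_iff[of n "x - y + 1"] by (simp add: algebra_simps)

text \<open>Makes a hole out of \<open>n\<close> listed vertices: checking pairs
  \<open>i < j\<close> suffices, as symmetry and irreflexivity give the other pairs and
  \<open>mod n\<close> extends the listing to all integers.\<close>

lemma holeI:
  fixes g :: "int \<Rightarrow> 'a"
  assumes "4 \<le> n" and inj: "inj_on g {0..<n}" and "sym E" and irr: "\<And>x. (x, x) \<notin> E"
    and adj: "\<And>i j. 0 \<le> i \<Longrightarrow> i < j \<Longrightarrow> j < n \<Longrightarrow>
      (g i, g j) \<in> E \<longleftrightarrow> j = i + 1 \<or> (i = 0 \<and> j = n - 1)"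
  shows "hole E n (\<lambda>i. g (i mod n))"
  unfolding hole_def
proof (intro conjI allI)
  fix i j :: int
  define a b where "a = i mod n" and "b = j mod n"
  have ab: "0 \<le> a" "a < n" "0 \<le> b" "b < n"
    using \<open>4 \<le> n\<close> by (auto simp: a_def b_def)
  have "n dvd i - j \<longleftrightarrow> a = b"
    by (auto simp: a_def b_def mod_eq_dvd_iff)
  then show "g (i mod n) = g (j mod n) \<longleftrightarrow> n dvd i - j"
    using inj ab by (auto simp: a_def[symmetric] b_def[symmetric] inj_on_def)
  have "(i - j - 1) mod n = (a - b - 1) mod n" "(j - i - 1) mod n = (b - a - 1) mod n"
    by (intro mod_diff_cong; simp add: a_def b_def)+
  then have dvd: "n dvd i - j - 1 \<longleftrightarrow> n dvd a - b - 1" "n dvd j - i - 1 \<longleftrightarrow> n dvd b - a - 1"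
    by (simp_all add: dvd_eq_mod_eq_0)
  have 1: "n dvd i - j - 1 \<longleftrightarrow> a = b + 1 \<or> (a = 0 \<and> b = n - 1)"
    unfolding dvd using dvd_pred_iff[OF ab] \<open>4 \<le> n\<close> by simp
  have "n dvd i - j + 1 \<longleftrightarrow> n dvd j - i - 1"
    by (rule dvd_diff_add_one_iff)
  also have "\<dots> \<longleftrightarrow> n dvd b - a - 1"
    by (fact dvd(2))
  finally have 2: "n dvd i - j + 1 \<longleftrightarrow> b = a + 1 \<or> (b = 0 \<and> a = n - 1)"
    using dvd_pred_iff[OF ab(3,4,1,2)] \<open>4 \<le> n\<close> by simp
  have "(g a, g b) \<in> E \<longleftrightarrow> a = b + 1 \<or> (a = 0 \<and> b = n - 1) \<or> b = a + 1 \<or> (b = 0 \<and> a = n - 1)"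
  proof (cases a b rule: linorder_cases)
    case less
    then show ?thesis using adj[of a b] ab by auto
  next
    case equal
    then show ?thesis using irr \<open>4 \<le> n\<close> by auto
  next
    case greater
    then show ?thesis using adj[of b a] ab symD[OF \<open>sym E\<close>] by auto
  qed
  then show "(g (i mod n), g (j mod n)) \<in> E \<longleftrightarrow> n dvd i - j - 1 \<or> n dvd i - j + 1"
    unfolding 1 2 by (auto simp: a_def[symmetric] b_def[symmetric])
qed (fact \<open>4 \<le> n\<close>)

text \<open>Converse of \<open>holeI\<close>. Both orientations follow because the adjacency
  condition in \<open>hole\<close> is itself symmetric in \<open>i\<close> and
  \<open>j\<close>.\<close>

lemma hole_adj:
  assumes "hole E n f" "0 \<le> i" "i < j" "j < n"
  shows "(f i, f j) \<in> E \<longleftrightarrow> j = i + 1 \<or> (i = 0 \<and> j = n - 1)"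
    and "(f j, f i) \<in> E \<longleftrightarrow> j = i + 1 \<or> (i = 0 \<and> j = n - 1)"
proof -
  have n: "2 \<le> n" using assms by (auto simp: hole_def)
  have "(f i, f j) \<in> E \<longleftrightarrow> n dvd i - j - 1 \<or> n dvd j - i - 1"
    "(f j, f i) \<in> E \<longleftrightarrow> n dvd i - j - 1 \<or> n dvd j - i - 1"
    using assms(1) dvd_diff_add_one_iff unfolding hole_def by blast+
  then show "(f i, f j) \<in> E \<longleftrightarrow> j = i + 1 \<or> (i = 0 \<and> j = n - 1)"
    "(f j, f i) \<in> E \<longleftrightarrow> j = i + 1 \<or> (i = 0 \<and> j = n - 1)"
    using dvd_pred_iff[of i n j] dvd_pred_iff[of j n i] assms n by auto
qed

lemma hole_inj_on:
  assumes "hole E n f"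
  shows "inj_on f {0..<n}"
proof (rule inj_onI)
  fix i j assume "i \<in> {0..<n}" "j \<in> {0..<n}" "f i = f j"
  then show "i = j"
    using assms dvd_iff_of_bounds[of n "i - j"] by (auto simp: hole_def)
qed

lemma hole_shift:
  assumes "hole E n f"
  shows "hole E n (\<lambda>i. f (i + k))"
  using assms unfolding hole_def by simp

lemma hole_reflect:
  assumes "hole E n f"
  shows "hole E n (\<lambda>i. f (- i))"
proof -
  have eq: "n dvd - i - - j \<longleftrightarrow> n dvd i - j" "n dvd - i - - j - 1 \<longleftrightarrow> n dvd i - j + 1"
    "n dvd - i - - j + 1 \<longleftrightarrow> n dvd i - j - 1" for i j :: int
    using dvd_minus_iff[of n "i - j"] dvd_minus_iff[of n "i - j + 1"] dvd_minus_iff[of n "i - j - 1"]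
    by (simp_all add: algebra_simps)
  note f = assms[unfolded hole_def]
  have "f (- i) = f (- j) \<longleftrightarrow> n dvd i - j"
    "(f (- i), f (- j)) \<in> E \<longleftrightarrow> n dvd i - j - 1 \<or> n dvd i - j + 1" for i j
    using f eq[of i j] by blast+
  then show ?thesis using f unfolding hole_def by blast
qed

lemma hole_mod:
  assumes "hole E n f"
  shows "f (i mod n) = f i"
  using assms unfolding hole_def by (simp add: mod_eq_dvd_iff[symmetric])

section \<open>Holes versus induced cycles given as arc lists\<close>

lemma awalk_of_fun:
  fixes g :: "nat \<Rightarrow> 'a"
  shows "pcas (g i) (map (\<lambda>k. (g k, g (Suc k))) [i..<i + m]) (g (i + m))"
    and "pawalk_verts (g i) (map (\<lambda>k. (g k, g (Suc k))) [i..<i + m]) = map g [i..<Suc (i + m)]"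
proof -
  have "pcas (g i) (map (\<lambda>k. (g k, g (Suc k))) [i..<i + m]) (g (i + m)) \<and>
    pawalk_verts (g i) (map (\<lambda>k. (g k, g (Suc k))) [i..<i + m]) = map g [i..<Suc (i + m)]"
  proof (induction m arbitrary: i)
    case (Suc m)
    have "[i..<i + Suc m] = i # [Suc i..<Suc i + m]"
      "[i..<Suc (i + Suc m)] = i # [Suc i..<Suc (Suc i + m)]"
      by (simp_all add: upt_conv_Cons)
    then show ?case using Suc[of "Suc i"] by simp
  qed simp
  then show "pcas (g i) (map (\<lambda>k. (g k, g (Suc k))) [i..<i + m]) (g (i + m))"
    and "pawalk_verts (g i) (map (\<lambda>k. (g k, g (Suc k))) [i..<i + m]) = map g [i..<Suc (i + m)]"
    by blast+
qed

lemma pcas_nth: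
  assumes "pcas u p v" "p \<noteq> []"
  shows "fst (p ! 0) = u" "snd (p ! (length p - 1)) = v"
    "\<And>k. Suc k < length p \<Longrightarrow> snd (p ! k) = fst (p ! Suc k)"
    "pawalk_verts u p = map fst p @ [v]"
proof -
  have "fst (p ! 0) = u \<and> snd (p ! (length p - 1)) = v \<and>
    (\<forall>k. Suc k < length p \<longrightarrow> snd (p ! k) = fst (p ! Suc k)) \<and> pawalk_verts u p = map fst p @ [v]"
    using assms
  proof (induction p arbitrary: u)
    case (Cons e es)
    show ?case
    proof (cases "es = []")
      case False
      then show ?thesis
        using Cons by (auto simp: nth_Cons split: nat.splits)
    qed (use Cons in auto)
  qed simp
  then show "fst (p ! 0) = u" "snd (p ! (length p - 1)) = v"
    "\<And>k. Suc k < length p \<Longrightarrow> snd (p ! k) = fst (p ! Suc k)"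
    "pawalk_verts u p = map fst p @ [v]" by auto
qed

lemma cycle_with_proj:
  "pre_digraph.cycle (with_proj G) p \<longleftrightarrow>
    (\<exists>u. u \<in> pverts G \<and> set p \<subseteq> parcs G \<and> pcas u p u \<and> distinct (tl (pawalk_verts u p)) \<and> p \<noteq> [])"
  by (simp add: pre_digraph.cycle_def pre_digraph.awalk_def cas_with_proj_eq
      awalk_verts_with_proj_eq)

lemma induced_cycle_of_hole:
  assumes "pair_graph G" and hole: "hole (parcs G) n f"
  obtains p where "induced_cycle G p" "4 \<le> length p"
proof
  interpret pair_graph G by fact
  define N where "N = nat n"
  have N: "4 \<le> N" "n = int N" using hole by (auto simp: N_def hole_def)
  define g where "g k = f (int k)" for k
  define p where "p = map (\<lambda>k. (g k, g (Suc k))) [0..<N]"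
  have adj: "(f i, f j) \<in> parcs G \<longleftrightarrow> n dvd i - j - 1 \<or> n dvd i - j + 1" for i j
    using hole by (auto simp: hole_def)
  have f_eq: "f i = f j \<longleftrightarrow> n dvd i - j" for i j
    using hole by (auto simp: hole_def)
  have gS: "(g k, g (Suc k)) \<in> parcs G" for k
    by (simp add: g_def adj)
  have g0: "g N = g 0" by (simp add: g_def f_eq N)
  have set_p: "set p = (\<lambda>k. (g k, g (Suc k))) ` {0..<N}" by (auto simp: p_def)
  have sub: "set p \<subseteq> parcs G" using gS set_p by auto
  have verts: "fst ` set p = g ` {0..<N}" by (auto simp: set_p image_image)
  have vsub: "g ` {0..<N} \<subseteq> pverts G" using gS in_arcsD1 by blast
  \<comment> \<open>\<open>cycle\<close> asks for distinctness of the tail of the vertex list, here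
    \<open>g 1, ..., g N\<close>; hence the range shifted by one.\<close>
  have "inj_on g {1..<Suc N}"
  proof (rule inj_onI)
    fix i j assume "i \<in> {1..<Suc N}" "j \<in> {1..<Suc N}" "g i = g j"
    then show "i = j"
      using dvd_iff_of_bounds[of n "int i - int j"] by (auto simp: g_def f_eq N)
  qed
  then have dist: "distinct (map g [1..<Suc N])"
    by (simp add: distinct_map del: upt_Suc)
  have cyc: "pre_digraph.cycle (with_proj G) p"
    unfolding cycle_with_proj
  proof (intro exI[of _ "g 0"] conjI)
    show "pcas (g 0) p (g 0)" using awalk_of_fun(1)[of g 0 N] g0 by (simp add: p_def)
    have "pawalk_verts (g 0) p = map g [0..<Suc N]"
      using awalk_of_fun(2)[of g 0 N] by (simp add: p_def)
    also have "tl \<dots> = map g [1..<Suc N]" by (simp add: map_tl[symmetric] del: upt_Suc)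
    finally show "distinct (tl (pawalk_verts (g 0) p))" using dist by simp
  qed (use sub N vsub in \<open>auto simp: p_def\<close>)
  define C where "C = cycle_graph p"
  have C: "pverts C = g ` {0..<N}" "parcs C = set p \<union> (set p)\<inverse>"
    by (auto simp: C_def cycle_graph_def verts)
  \<comment> \<open>\<open>p\<close> lists the arcs starting at indices below \<open>N\<close>; the
    arc at an arbitrary integer \<open>i\<close> equals the one at \<open>i mod n\<close>.\<close>
  have in_p: "(f i, f (i + 1)) \<in> set p" for i
  proof -
    have "(f i, f (i + 1)) = (g (nat (i mod n)), g (Suc (nat (i mod n))))"
      using N by (auto simp: g_def f_eq mod_eq_dvd_iff[symmetric] mod_simps add.commute)
    moreover have "nat (i mod n) \<in> {0..<N}" using N by (auto simp: nat_less_iff)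
    ultimately show ?thesis unfolding set_p by blast
  qed
  have gf: "g k \<in> g ` {0..<N}" for k
    using verts in_p[of "int k"] by (force simp: g_def)
  \<comment> \<open>Inducedness: an arc of \<open>G\<close> between cycle vertices has indices
    differing by one modulo \<open>n\<close>, so it or its reverse occurs in
    \<open>p\<close>.\<close>
  have Csub: "parcs C = {e \<in> parcs G. fst e \<in> pverts C \<and> snd e \<in> pverts C}"
  proof (intro set_eqI iffI)
    fix e assume "e \<in> parcs C"
    then show "e \<in> {e \<in> parcs G. fst e \<in> pverts C \<and> snd e \<in> pverts C}"
      using gf gS arcs_symmetric by (auto simp: C set_p)
  next
    fix e assume e: "e \<in> {e \<in> parcs G. fst e \<in> pverts C \<and> snd e \<in> pverts C}"
    then obtain i j where ij: "e = (f i, f j)" by (cases e) (auto simp: C g_def)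
    then consider "n dvd i - j - 1" | "n dvd i - j + 1" using e adj by auto
    then show "e \<in> parcs C"
    proof cases
      case 1
      then have "f i = f (j + 1)" by (simp add: f_eq algebra_simps)
      then show ?thesis using in_p[of j] by (auto simp: ij C)
    next
      case 2
      then have "f (i + 1) = f j" by (simp add: f_eq algebra_simps)
      then show ?thesis using in_p[of i] by (auto simp: ij C)
    qed
  qed
  have "pair_wf_digraph C"
    using Csub by unfold_locales auto
  then have "induced_subgraph (with_proj C) (with_proj G)"
    using Csub vsub pair_wf_digraph by (auto simp: induced_subgraph_def subgraph_def wf_digraph_wp_iff C(1))
  then show "induced_cycle G p" "4 \<le> length p"
    using cyc N by (auto simp: induced_cycle_def C_def p_def)
qed

lemma hole_of_induced_cycle:
  assumes "pair_graph G" and "induced_cycle G p" "4 \<le> length p"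
  obtains n f where "hole (parcs G) n f"
proof
  interpret pair_graph G by fact
  define N where "N = length p"
  define g where "g k = fst (p ! k)" for k
  obtain u where u: "set p \<subseteq> parcs G" "pcas u p u" "distinct (tl (pawalk_verts u p))" "p \<noteq> []"
    using assms by (auto simp: induced_cycle_def cycle_with_proj)
  note nth = pcas_nth[OF u(2,4)]
  have ind: "induced_subgraph (with_proj (cycle_graph p)) (with_proj G)"
    using assms by (simp add: induced_cycle_def)
  \<comment> \<open>The cycle condition gives distinctness of the vertices after the first, followed
    by the closing \<open>u\<close>; rotating \<open>u\<close> to the front gives it for
    \<open>map fst p\<close>.\<close>
  have "hd (map fst p) = u" using nth(1) u(4) by (simp add: hd_conv_nth)
  then have "map fst p = u # tl (map fst p)"
    using u(4) by (metis list.collapse map_is_Nil_conv)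
  moreover have "distinct (tl (map fst p) @ [u])" using u nth(4) by simp
  ultimately have "distinct (map fst p)" by (metis distinct1_rotate rotate1.simps(2))
  then have inj: "g i = g j \<longleftrightarrow> i = j" if "i < N" "j < N" for i j
    using that by (auto simp: g_def N_def distinct_conv_nth)
  \<comment> \<open>The \<open>mod\<close> accounts for the last arc, which returns to
    \<open>g 0\<close>.\<close>
  have p: "p ! k = (g k, g (Suc k mod N))" if "k < N" for k
  proof (cases "Suc k < N")
    case True
    then show ?thesis using nth(3)[of k] by (auto simp: g_def N_def prod_eq_iff)
  next
    case False
    then have "k = length p - 1" "Suc k = N" using that by (auto simp: N_def)
    then show ?thesis using nth(1,2) by (auto simp: g_def prod_eq_iff)
  qed
  have set_p: "e \<in> set p \<longleftrightarrow> (\<exists>k<N. e = (g k, g (Suc k mod N)))" for e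
    using p by (auto simp: in_set_conv_nth N_def) 
  have N: "4 \<le> N" using assms by (simp add: N_def)
  show "hole (parcs G) (int N) (\<lambda>i. g (nat (i mod int N)))"
  proof (rule holeI)
    show "inj_on (\<lambda>i. g (nat i)) {0..<int N}"
      by (rule inj_onI) (auto simp: inj nat_less_iff)
    show "sym (parcs G)" using arcs_symmetric by (auto intro: symI)
    show "(x, x) \<notin> parcs G" for x using no_loops' by blast
    fix i j :: int assume ij: "0 \<le> i" "i < j" "j < int N"
    define a b where "a = nat i" and "b = nat j"
    have ab: "a < b" "b < N" "i = int a" "j = int b" using ij by (auto simp: a_def b_def)
    have "(g a, g b) \<in> parcs G \<longleftrightarrow> (g a, g b) \<in> set p \<union> (set p)\<inverse>"
    proof -
      have "g k \<in> fst ` set p" if "k < N" for k using that by (metis set_p fst_conv image_eqI)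
      then show ?thesis using ind ab by (auto simp: induced_subgraph_def cycle_graph_def)
    qed
    also have "\<dots> \<longleftrightarrow> b = Suc a \<or> (a = 0 \<and> b = N - 1)"
    proof -
      have 1: "(g x, g y) \<in> set p \<longleftrightarrow> y = Suc x mod N" if "x < N" "y < N" for x y
      proof -
        have "Suc k mod N < N" for k using that by auto
        then show ?thesis using that inj by (auto simp: set_p)
      qed
      have "(g a, g b) \<in> set p \<longleftrightarrow> b = Suc a" using ab 1[of a b] by auto
      moreover have "(g b, g a) \<in> set p \<longleftrightarrow> (a = 0 \<and> b = N - 1)"
        using ab 1[of b a] by (cases "Suc b = N") auto
      ultimately show ?thesis by auto
    qed
    finally show "(g (nat i), g (nat j)) \<in> parcs G \<longleftrightarrow> j = i + 1 \<or> (i = 0 \<and> j = int N - 1)"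
      using ab by (auto simp: a_def[symmetric] b_def[symmetric])
  qed (use N in auto)
qed

text \<open>Reduces chordality to a property of the arc relation, so that the later arguments about
  cycles need no walks.\<close>

lemma chordal_iff_no_hole:
  assumes "pair_graph G"
  shows "chordal G \<longleftrightarrow> (\<forall>n f. \<not> hole (parcs G) n f)"
proof
  assume "chordal G"
  show "\<forall>n f. \<not> hole (parcs G) n f"
  proof (intro allI notI)
    fix n f assume "hole (parcs G) n f"
    then obtain p where "induced_cycle G p" "4 \<le> length p"
      by (rule induced_cycle_of_hole[OF assms])
    then show False using \<open>chordal G\<close> by (auto simp: chordal_def)
  qed
next
  assume no_hole: "\<forall>n f. \<not> hole (parcs G) n f"
  show "chordal G"
    unfolding chordal_def
  proof (rule notI, elim exE conjE)
    fix p assume "induced_cycle G p" "4 \<le> length p"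
    then obtain n f where "hole (parcs G) n f"
      by (rule hole_of_induced_cycle[OF assms])
    then show False using no_hole by blast
  qed
qed

section \<open>Separators, reachability and components\<close>

lemma ex_minimal_subset:
  assumes "finite A" "P A"
  obtains B where "B \<subseteq> A" "P B" "\<And>B'. B' \<subset> B \<Longrightarrow> \<not> P B'"
  using assms
proof (induction A arbitrary: thesis rule: finite_psubset_induct)
  case (psubset A)
  show ?case
  proof (cases "\<exists>B. B \<subset> A \<and> P B")
    case True
    then obtain B where B: "B \<subset> A" "P B" by blast
    obtain B' where "B' \<subseteq> B" "P B'" "\<And>B''. B'' \<subset> B' \<Longrightarrow> \<not> P B''"
      using psubset.IH[OF B(1) _ B(2)] by blast
    then show ?thesis using psubset.prems(1)[of B'] B by blast
  next
    case False
    then show ?thesis using psubset.prems by blast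
  qed
qed

text \<open>As arcs are symmetric, the strongly connected component of a vertex of
  \<open>G - S\<close> consists of all vertices reachable from it there, so lying in different
  components means being unreachable.\<close>

lemma separator_iff:
  assumes "pair_graph G"
  shows "separator G u v S \<longleftrightarrow> S \<subseteq> pverts G - {u, v} \<and> u \<in> pverts G \<and> v \<in> pverts G \<and>
    (u, v) \<notin> rtrancl_on (pverts G - S) (parcs G)"
proof -
  interpret pair_graph G by fact
  let ?A = "pverts G - S"
  let ?H = "with_proj G \<restriction> ?A"
  interpret H: wf_digraph ?H by (rule wellformed_induce_subgraph)
  have ends: "arcs_ends ?H = {(x, y) \<in> parcs G. x \<in> ?A \<and> y \<in> ?A}"
    by (auto simp: arcs_ends_conv induce_subgraph_def image_iff)
  have "rtrancl_on ?A (arcs_ends ?H) = rtrancl_on ?A (parcs G)"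
  proof (intro set_eqI iffI; clarify)
    fix x y assume "(x, y) \<in> rtrancl_on ?A (arcs_ends ?H)"
    then show "(x, y) \<in> rtrancl_on ?A (parcs G)"
      by (rule rtrancl_on_mono[rotated 2]) (auto simp: ends)
  next
    fix x y assume "(x, y) \<in> rtrancl_on ?A (parcs G)"
    then show "(x, y) \<in> rtrancl_on ?A (arcs_ends ?H)"
      by (induction rule: rtrancl_on_induct) (auto simp: ends intro: rtrancl_on_into_rtrancl_on)
  qed
  then have reach: "x \<rightarrow>\<^sup>*\<^bsub>?H\<^esub> y \<longleftrightarrow> (x, y) \<in> rtrancl_on ?A (parcs G)" for x y
    by (simp add: reachable_def)
  have symR: "sym (rtrancl_on ?A (parcs G))"
    using arcs_symmetric by (intro rtrancl_on_sym symI) auto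
  have eq: "x \<in> C \<Longrightarrow> C \<in> H.sccs_verts \<Longrightarrow> C = {y. (x, y) \<in> rtrancl_on ?A (parcs G)}" for x C
    unfolding H.in_sccs_verts_conv_reachable reach using symD[OF symR] by blast
  have scc: "x \<in> ?A \<Longrightarrow> {y. (x, y) \<in> rtrancl_on ?A (parcs G)} \<in> H.sccs_verts" for x
    unfolding H.in_sccs_verts_conv_reachable reach
    using symD[OF symR] rtrancl_on_trans[of _ _ ?A "parcs G"] by blast
  have self: "x \<in> ?A \<Longrightarrow> (x, x) \<in> rtrancl_on ?A (parcs G)" for x by auto
  show ?thesis
    unfolding separator_def
  proof (intro conj_cong refl iffI)
    assume S: "S \<subseteq> pverts G - {u, v}"
      and "\<exists>C\<in>H.sccs_verts. \<exists>D\<in>H.sccs_verts. C \<noteq> D \<and> u \<in> C \<and> v \<in> D"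
    then obtain C D where "C \<in> H.sccs_verts" "D \<in> H.sccs_verts" "C \<noteq> D" "u \<in> C" "v \<in> D"
      by blast
    moreover from this have "v \<notin> C" using H.sccs_verts_disjoint by blast
    then have "(u, v) \<notin> rtrancl_on ?A (parcs G)" using eq[OF \<open>u \<in> C\<close> \<open>C \<in> H.sccs_verts\<close>] by blast
    ultimately show "u \<in> pverts G \<and> v \<in> pverts G \<and> (u, v) \<notin> rtrancl_on ?A (parcs G)"
      using H.sccs_verts_subsets[of C] H.sccs_verts_subsets[of D] by auto
  next
    assume S: "S \<subseteq> pverts G - {u, v}"
      and uv: "u \<in> pverts G \<and> v \<in> pverts G \<and> (u, v) \<notin> rtrancl_on ?A (parcs G)"
    define C D where "C = {y. (u, y) \<in> rtrancl_on ?A (parcs G)}"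
      and "D = {y. (v, y) \<in> rtrancl_on ?A (parcs G)}"
    have "C \<in> H.sccs_verts" "D \<in> H.sccs_verts" "u \<in> C" "v \<in> D"
      unfolding C_def D_def using scc[of u] scc[of v] self[of u] self[of v] S uv by auto
    moreover have "v \<notin> C" using uv by (simp add: C_def)
    ultimately show "\<exists>C\<in>H.sccs_verts. \<exists>D\<in>H.sccs_verts. C \<noteq> D \<and> u \<in> C \<and> v \<in> D"
      by blast
  qed
qed

text \<open>For symmetric \<open>E\<close> these are the vertex sets of the connected components of
  the graph induced on \<open>A\<close>; \<open>rtrancl_on\<close> matches the form of
  \<open>separator_iff\<close>.\<close>

definition components :: "'a rel \<Rightarrow> 'a set \<Rightarrow> 'a set set" where
  "components E A = (\<lambda>c. rtrancl_on A E `` {c}) ` A"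

lemma component_subset: "C \<in> components E A \<Longrightarrow> C \<subseteq> A"
  by (auto simp: components_def dest: in_rtrancl_on_in_F)

lemma component_nonempty: "C \<in> components E A \<Longrightarrow> C \<noteq> {}"
  by (auto simp: components_def)

lemma component_closed:
  assumes "C \<in> components E A" "a \<in> C" "(a, b) \<in> E" "b \<in> A"
  shows "b \<in> C"
  using assms by (auto simp: components_def intro: rtrancl_on_into_rtrancl_on)

text \<open>A path in \<open>A\<close> from the representative \<open>c\<close> visits only vertices
  reachable from \<open>c\<close>, so it stays in \<open>C\<close>; symmetry then joins any two
  vertices through \<open>c\<close>.\<close>

lemma component_connected:
  assumes "sym E" "C \<in> components E A" "a \<in> C" "b \<in> C"
  shows "(a, b) \<in> rtrancl_on C E"
proof -
  obtain c where c: "c \<in> A" "C = rtrancl_on A E `` {c}"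
    using assms by (auto simp: components_def)
  have *: "(c, x) \<in> rtrancl_on C E" if "x \<in> C" for x
  proof -
    have "(c, x) \<in> rtrancl_on A E" using that c by simp
    then show ?thesis
    proof (induction rule: rtrancl_on_induct)
      case base
      then show ?case using c by auto
    next
      case (step y z)
      then show ?case using c by (auto intro: rtrancl_on_into_rtrancl_on)
    qed
  qed
  have "sym (rtrancl_on C E)" using assms(1) by (rule rtrancl_on_sym)
  then show ?thesis using *[OF assms(3)] *[OF assms(4)] by (meson rtrancl_on_trans symD)
qed

lemma component_eq:
  assumes "sym E" "C \<in> components E A" "D \<in> components E A" "x \<in> C" "x \<in> D"
  shows "C = D"
proof -
  have "P \<subseteq> Q" if "P \<in> components E A" "Q \<in> components E A" "x \<in> P" "x \<in> Q" for P Q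
  proof
    fix y assume "y \<in> P"
    then have "(x, y) \<in> rtrancl_on P E" using component_connected assms(1) that by metis
    then show "y \<in> Q"
    proof (induction rule: rtrancl_on_induct)
      case base
      then show ?case using that by simp
    next
      case (step y z)
      then show ?case using component_closed[OF that(2)] component_subset[OF that(1)] by blast
    qed
  qed
  then show ?thesis using assms by blast
qed

lemma reach_through_component:
  assumes "sym E" "C \<in> components E A" "x \<in> E `` C" "y \<in> E `` C" "C \<union> {x, y} \<subseteq> B"
  shows "(x, y) \<in> rtrancl_on B E"
proof -
  obtain a b where ab: "a \<in> C" "(a, x) \<in> E" "b \<in> C" "(b, y) \<in> E" using assms by blast
  have "(a, b) \<in> rtrancl_on C E" using component_connected assms ab by metis
  then have "(a, b) \<in> rtrancl_on B E" by (rule rtrancl_on_mono[rotated 2]) (use assms in auto)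
  then have "(a, y) \<in> rtrancl_on B E" using ab assms by (auto intro: rtrancl_on_into_rtrancl_on)
  moreover have "(x, a) \<in> E" using ab assms(1) by (auto dest: symD)
  ultimately show ?thesis using assms by (auto intro: converse_rtrancl_on_into_rtrancl_on)
qed

text \<open>Reachability grows as fewer vertices are deleted, so restoring single vertices is a
  sufficient test for minimality.\<close>

lemma minimal_pair_separatorI:
  assumes "pair_graph G" "separator G u v S"
    and "\<And>s. s \<in> S \<Longrightarrow> (u, v) \<in> rtrancl_on (pverts G - (S - {s})) (parcs G)"
  shows "minimal_pair_separator G u v S"
  unfolding minimal_pair_separator_def
proof (intro conjI notI)
  assume "\<exists>S'. S' \<subset> S \<and> separator G u v S'"
  then obtain S' where S': "S' \<subset> S" "separator G u v S'" by blast
  then obtain s where "s \<in> S" "s \<notin> S'" by blast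
  then have "(u, v) \<in> rtrancl_on (pverts G - S') (parcs G)"
    using S'(1) by (intro rtrancl_on_mono[OF order_refl _ assms(3)[of s]]) auto
  then show False using S' separator_iff[OF assms(1)] by blast
qed fact

section \<open>Two minimal separators from a family of components\<close>

text \<open>The separator half of the argument, free of triangulations: \<open>cover\<close>
  supplies the family to be minimised, \<open>not_full\<close> a vertex of \<open>X\<close> that
  \<open>S\<close> cuts off from \<open>C\<close>.\<close>

lemma minimal_separators_of_cover:
  assumes G: "pair_graph G" and X: "X \<subseteq> pverts G" and "\<not> clique G X"
    and not_full: "\<And>C. C \<in> components (parcs G) (pverts G - X) \<Longrightarrow> \<not> X \<subseteq> parcs G `` C"
    and cover: "\<And>u v. u \<in> X \<Longrightarrow> v \<in> X \<Longrightarrow> u \<noteq> v \<Longrightarrow> (u, v) \<notin> parcs G \<Longrightarrow>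
      \<exists>C \<in> components (parcs G) (pverts G - X). {u, v} \<subseteq> parcs G `` C"
  shows "\<exists>S T. minimal_separator G S \<and> minimal_separator G T \<and> S \<noteq> T \<and> X \<subseteq> S \<union> T"
proof -
  interpret pair_graph G by fact
  let ?V = "pverts G" and ?E = "parcs G"
  let ?K = "components ?E (?V - X)"
  have symE: "sym ?E" using arcs_symmetric by (auto intro: symI)
  define covers where "covers CC \<longleftrightarrow> (\<forall>u\<in>X. \<forall>v\<in>X. u \<noteq> v \<longrightarrow> (u, v) \<notin> ?E \<longrightarrow>
      (\<exists>C\<in>CC. {u, v} \<subseteq> ?E `` C))" for CC
  have "finite ?K" using pair_finite_verts by (simp add: components_def)
  moreover have "covers ?K" using cover by (simp add: covers_def)
  ultimately obtain CC where CC: "CC \<subseteq> ?K" "covers CC"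
    and min: "\<And>CC'. CC' \<subset> CC \<Longrightarrow> \<not> covers CC'"
    using ex_minimal_subset[of ?K covers] by blast
  have "\<not> covers {}" using \<open>\<not> clique G X\<close> X by (auto simp: clique_def covers_def)
  then obtain C where C: "C \<in> CC" using CC by (metis all_not_in_conv)
  define CC' where "CC' = CC - {C}"
  \<comment> \<open>By minimality, dropping \<open>C\<close> uncovers some pair, which no other
    member covers.\<close>
  have "\<not> covers CC'" using min C by (auto simp: CC'_def)
  then obtain u v where uv: "u \<in> X" "v \<in> X" "u \<noteq> v" "(u, v) \<notin> ?E"
    and none: "\<And>D. D \<in> CC' \<Longrightarrow> \<not> {u, v} \<subseteq> ?E `` D"
    by (auto simp: covers_def)
  have CK: "C \<in> ?K" and CX: "C \<inter> X = {}" "C \<subseteq> ?V" using C CC component_subset by fastforce+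
  define S where "S = ?E `` C - C"
  have S_sub: "S \<subseteq> X"
    using component_closed[OF CK] in_arcsD2 by (auto simp: S_def)
  have S_eq: "?E `` C \<inter> X = S" using S_sub CX by (auto simp: S_def)
  obtain x where x: "x \<in> X" "x \<notin> S" using not_full[OF CK] S_eq by blast
  have xV: "x \<in> ?V" using x X by auto
  obtain c where c: "c \<in> C" using component_nonempty CK by blast
  have cV: "c \<in> ?V" using c CX by auto
  \<comment> \<open>As \<open>y\<close> has no neighbour in \<open>C\<close>, a pair
    \<open>y, z\<close> that is not adjacent must be covered by a member other than
    \<open>C\<close>, and a path runs through that member.\<close>
  have join: "(y, z) \<in> rtrancl_on B ?E"
    if yz: "y \<in> X" "z \<in> X" "y \<notin> S" "\<Union>CC' \<union> {y, z} \<subseteq> B" for y z B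
  proof (cases "y = z \<or> (y, z) \<in> ?E")
    case True
    moreover have "(y, y) \<in> rtrancl_on B ?E" "z \<in> B" using yz by auto
    ultimately show ?thesis using rtrancl_on_into_rtrancl_on[of y y B ?E z] by blast
  next
    case False
    then obtain D where D: "D \<in> CC" "{y, z} \<subseteq> ?E `` D"
      using CC(2) False yz(1,2) unfolding covers_def by blast
    then have "D \<in> CC'" using that S_eq by (auto simp: CC'_def)
    then show ?thesis
      using D that CC symE by (intro reach_through_component[of ?E D "?V - X"]) auto
  qed
  have disj: "D \<inter> C = {}" "D \<inter> X = {}" "D \<subseteq> ?V" if "D \<in> CC'" for D
    using that CC component_eq[OF symE _ CK, of D] component_subset[of D ?E "?V - X"]
    by (auto simp: CC'_def)
  have Union_CC': "\<Union>CC' \<subseteq> ?V" "\<Union>CC' \<inter> X = {}"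
    using disj(2,3) by (auto simp: disjoint_iff subset_iff)
  have minS: "minimal_pair_separator G c x S"
  proof (rule minimal_pair_separatorI[OF G])
    have "b \<in> C" if "(c, b) \<in> rtrancl_on (?V - S) ?E" for b
      using that by (induction rule: rtrancl_on_induct) (use c in \<open>auto simp: S_def\<close>)
    then show "separator G c x S"
      unfolding separator_iff[OF G] using c CX x S_sub X xV cV by blast
    fix s assume s: "s \<in> S"
    obtain b where b: "b \<in> C" "(b, s) \<in> ?E" using s by (auto simp: S_def)
    have sV: "s \<in> ?V" using s S_sub X by auto
    have "(c, b) \<in> rtrancl_on C ?E" using component_connected symE CK c b by metis
    then have "(c, b) \<in> rtrancl_on (?V - (S - {s})) ?E"
      by (rule rtrancl_on_mono[rotated 2]) (use CX S_sub in auto)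
    then have "(c, s) \<in> rtrancl_on (?V - (S - {s})) ?E"
      using b sV by (auto intro: rtrancl_on_into_rtrancl_on)
    \<comment> \<open>\<open>x\<close> is outside \<open>S\<close>, so \<open>join\<close> applies;
      the members of \<open>CC'\<close> avoid \<open>X\<close> and therefore
      \<open>S\<close>.\<close>
    moreover have "(x, s) \<in> rtrancl_on (?V - (S - {s})) ?E"
      by (rule join) (use x s S_sub Union_CC' xV sV in auto)
    ultimately show "(c, x) \<in> rtrancl_on (?V - (S - {s})) ?E"
      using rtrancl_on_sym[OF symE] by (meson rtrancl_on_trans symD)
  qed
  have "(c, x) \<in> nonedges G"
  proof -
    have "(c, x) \<notin> ?E" using c x CX by (auto simp: S_def)
    then show ?thesis using c x CX cV xV by (auto simp: nonedges_def)
  qed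
  then have S: "minimal_separator G S" using minS by (auto simp: minimal_separator_def)
  define T0 where "T0 = ?V - ({u, v} \<union> \<Union>CC')"
  have T0: "?V - T0 = {u, v} \<union> \<Union>CC'" using uv X Union_CC' by (auto simp: T0_def)
  have "separator G u v T0"
  proof -
    \<comment> \<open>\<open>R\<close> contains everything reachable from \<open>u\<close> once
      \<open>T0\<close> is deleted: distinct members are not adjacent, and by \<open>none\<close> a
      member that sees \<open>u\<close> does not see \<open>v\<close>.\<close>
    define R where "R = {u} \<union> \<Union>{D \<in> CC'. u \<in> ?E `` D}"
    have "b \<in> R" if "(u, b) \<in> rtrancl_on (?V - T0) ?E" for b
      using that
    proof (induction rule: rtrancl_on_induct)
      case base
      then show ?case by (simp add: R_def)
    next
      case (step y z)
      have z: "z = u \<or> z = v \<or> (\<exists>D \<in> CC'. z \<in> D)" using step T0 by auto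
      show ?case
      proof (cases "y = u")
        case True
        then have "z \<noteq> v" using step uv by auto
        moreover have "z \<in> D \<Longrightarrow> u \<in> ?E `` D" for D
          using step True arcs_symmetric by blast
        ultimately show ?thesis using z by (auto simp: R_def)
      next
        case False
        then obtain D where D: "D \<in> CC'" "u \<in> ?E `` D" "y \<in> D" using step by (auto simp: R_def)
        have "z \<noteq> v" using none D step by blast
        moreover have "z \<in> D" if "z \<in> D'" "D' \<in> CC'" for D'
          using component_closed[of D ?E "?V - X" y z] D step that disj[of D'] CC
          by (auto simp: CC'_def)
        ultimately show ?thesis using z D by (auto simp: R_def)
      qed
    qed
    moreover have "v \<notin> R" using uv disj by (auto simp: R_def)
    ultimately show ?thesis
      unfolding separator_iff[OF G] using uv X by (auto simp: T0_def)
  qed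
  moreover have "finite T0" using pair_finite_verts by (simp add: T0_def)
  ultimately obtain T where T: "T \<subseteq> T0" "separator G u v T"
    "\<And>T'. T' \<subset> T \<Longrightarrow> \<not> separator G u v T'"
    using ex_minimal_subset[of T0 "separator G u v"] by blast
  have "(u, v) \<in> nonedges G" using uv X by (auto simp: nonedges_def)
  then have "minimal_separator G T"
    using T by (auto simp: minimal_separator_def minimal_pair_separator_def)
  moreover have "X - S \<subseteq> T"
  proof
    fix y assume y: "y \<in> X - S"
    show "y \<in> T"
    proof (rule ccontr)
      assume "y \<notin> T"
      \<comment> \<open>If \<open>y\<close> survives the deletion of \<open>T\<close>, then
        \<open>join\<close> connects it to both \<open>u\<close> and \<open>v\<close>, which
        \<open>T\<close> separates.\<close>
      then have sub: "\<Union>CC' \<union> {y, u, v} \<subseteq> ?V - T" using T(1) T0 y X uv by blast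
      have "(y, u) \<in> rtrancl_on (?V - T) ?E" "(y, v) \<in> rtrancl_on (?V - T) ?E"
        by (rule join; use y uv sub in auto)+
      then have "(u, v) \<in> rtrancl_on (?V - T) ?E"
        using rtrancl_on_sym[OF symE] by (meson rtrancl_on_trans symD)
      then show False using T(2) separator_iff[OF G] by blast
    qed
  qed
  moreover from this have "S \<noteq> T" using x by blast
  ultimately show ?thesis using S by blast
qed

section \<open>A vertex adjacent to a whole clique\<close>

text \<open>
  Let \<open>c\<close> in \<open>C\<close> have as many neighbours in \<open>X\<close> as possible. If \<open>c\<close> misses \<open>y\<close>, the last vertex of a
  shortest path in \<open>C\<close> from \<open>c\<close> to a neighbour of \<open>y\<close> is adjacent to \<open>y\<close> and, for lack of chordless
  cycles, to all neighbours of \<open>c\<close> in \<open>X\<close>.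
\<close>

lemma ex_common_neighbour_of_clique:
  assumes no_hole: "\<And>n f. \<not> hole E n f" and "sym E" and irr: "\<And>x. (x, x) \<notin> E"
    and "finite X" and clique: "\<And>x y. x \<in> X \<Longrightarrow> y \<in> X \<Longrightarrow> x \<noteq> y \<Longrightarrow> (x, y) \<in> E"
    and conn: "\<And>a b. a \<in> C \<Longrightarrow> b \<in> C \<Longrightarrow> (a, b) \<in> rtrancl_on C E"
    and "C \<noteq> {}" "C \<inter> X = {}" "X \<subseteq> E `` C"
  obtains c where "c \<in> C" "\<And>x. x \<in> X \<Longrightarrow> (c, x) \<in> E"
proof -
  note sym = symD[OF \<open>sym E\<close>]
  \<comment> \<open>The bound has to be strict, hence \<open>Suc (card X)\<close>; the
    \<open>SOME\<close> term is a witness of \<open>C \<noteq> {}\<close>.\<close>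
  have "\<exists>c. c \<in> C \<and> (\<forall>d. d \<in> C \<longrightarrow> card (E `` {d} \<inter> X) \<le> card (E `` {c} \<inter> X))"
    by (rule ex_has_greatest_nat[of _ "SOME c. c \<in> C" _ "Suc (card X)"])
      (use assms in \<open>auto simp: some_in_eq less_Suc_eq_le intro: card_mono\<close>)
  then obtain c where c: "c \<in> C"
    and max: "\<And>d. d \<in> C \<Longrightarrow> card (E `` {d} \<inter> X) \<le> card (E `` {c} \<inter> X)" by blast
  have "(c, y) \<in> E" if y: "y \<in> X" for y
  proof (rule ccontr)
    assume cy: "(c, y) \<notin> E"
    define R where "R = E \<inter> C \<times> C"
    \<comment> \<open>\<open>P k\<close>: some walk of length \<open>k\<close> inside
      \<open>C\<close> leads from \<open>c\<close> to a neighbour of \<open>y\<close>. The least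
      such \<open>k\<close> gives the shortest path \<open>p\<close>.\<close>
    define P where "P k \<longleftrightarrow> (\<exists>w. (c, w) \<in> R ^^ k \<and> (w, y) \<in> E)" for k
    obtain w where w: "w \<in> C" "(w, y) \<in> E" using y \<open>X \<subseteq> E `` C\<close> by blast
    have "(c, w) \<in> rtrancl_on C E" using conn c w by blast
    then have "(c, w) \<in> R\<^sup>*"
      by (induction rule: rtrancl_on_induct) (auto simp: R_def intro: rtrancl_into_rtrancl)
    then have "\<exists>k. P k" using w by (auto simp: P_def rtrancl_power)
    then obtain k where "P k" and least: "\<And>j. P j \<Longrightarrow> k \<le> j"
      by (metis LeastI Least_le)
    then obtain p where p0: "p 0 = c" and py: "(p k, y) \<in> E"
      and pR: "\<And>i. i < k \<Longrightarrow> (p i, p (Suc i)) \<in> R"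
      unfolding P_def relpow_fun_conv by blast
    have seg: "(p i, p (i + m)) \<in> R ^^ m" if "i + m \<le> k" for i m
      using that by (induction m) (auto simp: Suc_le_eq intro!: relcompI[OF _ pR])
    \<comment> \<open>Replacing the segment from \<open>p i\<close> to \<open>p j\<close> by a walk
      of length \<open>m\<close> cannot beat the least \<open>k\<close>. With \<open>m = 0\<close>
      this makes \<open>p\<close> injective, with \<open>m = 1\<close> chordless.\<close>
    have short: "j \<le> i + m" if "i \<le> k" "j \<le> k" "(p i, p j) \<in> R ^^ m" for i j m
    proof -
      have "(c, p i) \<in> R ^^ i" using seg[of 0 i] that p0 by simp
      then have "(c, p j) \<in> R ^^ (i + m)" using that by (auto simp: relpow_add)
      moreover have "(p j, p k) \<in> R ^^ (k - j)" using seg[of j "k - j"] that by simp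
      ultimately have "(c, p k) \<in> R ^^ (i + m + (k - j))"
        by (auto simp: relpow_add[of "i + m" "k - j"])
      then have "P (i + m + (k - j))" using py by (auto simp: P_def)
      then show ?thesis using least[of "i + m + (k - j)"] that by linarith
    qed
    have pC: "p i \<in> C" if "i \<le> k" for i
      using that pR[of "i - 1"] c p0 by (cases i) (auto simp: R_def)
    have p_inj: "i = j" if "i \<le> k" "j \<le> k" "p i = p j" for i j
      using short[of i j 0] short[of j i 0] that by simp
    have p_adj: "j = Suc i" if "i < j" "j \<le> k" "(p i, p j) \<in> E" for i j
      using short[of i j 1] that pC by (auto simp: R_def)
    have p_y: "i = k" if "i \<le> k" "(p i, y) \<in> E" for i
    proof -
      have "(c, p i) \<in> R ^^ i" using seg[of 0 i] that p0 by simp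
      then show ?thesis using least[of i] that by (auto simp: P_def)
    qed
    have "(p k, x) \<in> E" if x: "x \<in> X" "(c, x) \<in> E" for x
    proof (rule ccontr)
      assume kx: "(p k, x) \<notin> E"
      \<comment> \<open>The last neighbour \<open>p i\<close> of \<open>x\<close> on the path is
        chosen, so that \<open>x, p i, ..., p k, y\<close> has no chord at \<open>x\<close>.\<close>
      have "\<exists>i. (i \<le> k \<and> (p i, x) \<in> E) \<and> (\<forall>j. j \<le> k \<and> (p j, x) \<in> E \<longrightarrow> j \<le> i)"
        by (rule Nat.ex_has_greatest_nat[of _ 0 k]) (use x p0 in auto)
      then obtain i where i: "i \<le> k" "(p i, x) \<in> E"
        and last: "\<And>j. j \<le> k \<Longrightarrow> (p j, x) \<in> E \<Longrightarrow> j \<le> i" by blast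
      have "i < k" using i kx by (cases "i = k") auto
      have "x \<noteq> y" using x cy by auto
      \<comment> \<open>The cycle has \<open>k - i + 1\<close> path vertices besides
        \<open>x\<close> at position \<open>0\<close> and \<open>y\<close> at position
        \<open>m - 1\<close>; \<open>i < k\<close> makes its length at least 4.\<close>
      define m where "m = int k - int i + 3"
      define g where "g j = (if j = 0 then x else if j = m - 1 then y else p (nat (int i + j - 1)))"
        for j
      have "hole E m (\<lambda>i. g (i mod m))"
      proof (rule holeI)
        show "4 \<le> m" using \<open>i < k\<close> by (simp add: m_def)
        have mid: "nat (int i + j - 1) \<le> k" if "0 < j" "j < m - 1" for j
          using that by (auto simp: m_def)
        show "inj_on g {0..<m}"
        proof (rule inj_onI)
          fix a b assume ab: "a \<in> {0..<m}" "b \<in> {0..<m}" "g a = g b"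
          have gC: "g j \<in> C" if "0 < j" "j < m - 1" for j
            using pC mid that by (simp add: g_def)
          have *: "a = b" if "0 < a" "a < m - 1" "0 < b" "b < m - 1"
            using ab(3) that p_inj[OF mid mid, of a b] by (auto simp: g_def)
          have gX: "g j \<in> X" if "j = 0 \<or> j = m - 1" for j using x y that by (auto simp: g_def)
          consider "a = 0 \<or> a = m - 1" "b = 0 \<or> b = m - 1"
            | "a = 0 \<or> a = m - 1" "0 < b" "b < m - 1"
            | "b = 0 \<or> b = m - 1" "0 < a" "a < m - 1"
            | "0 < a" "a < m - 1" "0 < b" "b < m - 1"
            using ab by force
          then show "a = b"
          proof cases
            case 1
            then show ?thesis using ab \<open>x \<noteq> y\<close> by (auto simp: g_def split: if_splits)
          next
            case 2
            then show ?thesis using gC[of b] gX[of a] ab \<open>C \<inter> X = {}\<close> by auto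
          next
            case 3
            then show ?thesis using gC[of a] gX[of b] ab \<open>C \<inter> X = {}\<close> by auto
          qed (rule *)
        qed
        fix a b :: int assume ab: "0 \<le> a" "a < b" "b < m"
        consider "a = 0" "b = m - 1" | "a = 0" "b < m - 1" | "0 < a" "b = m - 1" | "0 < a" "b < m - 1"
          using ab by force
        then show "(g a, g b) \<in> E \<longleftrightarrow> b = a + 1 \<or> (a = 0 \<and> b = m - 1)"
        proof cases
          case 1
          then show ?thesis using clique x y \<open>x \<noteq> y\<close> ab by (auto simp: g_def)
        next
          case 2
          have "(x, p (nat (int i + b - 1))) \<in> E \<longleftrightarrow> b = 1"
          proof
            assume "(x, p (nat (int i + b - 1))) \<in> E"
            then have "nat (int i + b - 1) \<le> i" using last sym mid 2 ab by auto
            then show "b = 1" using 2 ab by auto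
          qed (use i sym in auto)
          then show ?thesis using 2 ab by (auto simp: g_def)
        next
          case 3
          have "(p (nat (int i + a - 1)), y) \<in> E \<longleftrightarrow> b = a + 1"
          proof
            assume "(p (nat (int i + a - 1)), y) \<in> E"
            then have "nat (int i + a - 1) = k" using p_y mid[of a] 3 ab by auto
            then show "b = a + 1" using 3 ab by (auto simp: m_def)
          next
            assume "b = a + 1"
            then have "nat (int i + a - 1) = k" using 3 by (auto simp: m_def)
            then show "(p (nat (int i + a - 1)), y) \<in> E" using py by simp
          qed
          then show ?thesis using 3 ab by (auto simp: g_def)
        next
          case 4
          define s t where "s = nat (int i + a - 1)" and "t = nat (int i + b - 1)"
          have st: "s < t" "t \<le> k" "t = Suc s \<longleftrightarrow> b = a + 1"
            using 4 ab mid[of b] by (auto simp: s_def t_def)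
          have "(p s, p t) \<in> E \<longleftrightarrow> t = Suc s"
            using p_adj[OF st(1,2)] pR[of s] st by (auto simp: R_def)
          then show ?thesis using 4 ab st by (auto simp: g_def s_def t_def)
        qed
      qed (use irr \<open>sym E\<close> in auto)
      then show False using no_hole by blast
    qed
    \<comment> \<open>\<open>p k\<close> sees in \<open>X\<close> all that \<open>c\<close> sees and
      also \<open>y\<close>, against the choice of \<open>c\<close>.\<close>
    then have "E `` {c} \<inter> X \<subset> E `` {p k} \<inter> X" using py y cy by auto
    then have "card (E `` {c} \<inter> X) < card (E `` {p k} \<inter> X)"
      using \<open>finite X\<close> by (intro psubset_card_mono) auto
    then show False using max[of "p k"] pC by auto
  qed
  then show ?thesis using that c by blast
qed

section \<open>Holes at clique separators and after deletion of an edge\<close>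

text \<open>Going up from index \<open>0\<close>, the first vertex outside \<open>A\<close> is
  entered from \<open>A\<close>, so it lies in \<open>N\<close>; it comes before \<open>f j\<close>,
  which is not in \<open>N\<close>.\<close>

lemma hole_crosses:
  assumes "hole E n f" "f 0 \<in> A" "f j \<notin> A \<union> N" "0 < j"
    and out: "\<And>a b. a \<in> A \<Longrightarrow> (a, b) \<in> E \<Longrightarrow> b \<in> A \<union> N"
  shows "\<exists>i. 0 < i \<and> i < j \<and> f i \<in> N"
proof -
  define k where "k = (LEAST k. f (int k) \<notin> A)"
  have "f (int (nat j)) \<notin> A" using assms by auto
  then have k: "f (int k) \<notin> A" "k \<le> nat j"
    unfolding k_def by (rule LeastI, rule Least_le)
  have "k \<noteq> 0" using k assms by (cases k) auto
  then have "f (int (k - 1)) \<in> A"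
    using not_less_Least[of "k - 1" "\<lambda>k. f (int k) \<notin> A", folded k_def] by simp
  moreover have "(f (int (k - 1)), f (int k)) \<in> E"
    using assms(1) \<open>k \<noteq> 0\<close> unfolding hole_def by auto
  ultimately have "f (int k) \<in> N" using out k by blast
  moreover from this have "int k \<noteq> j" using assms by auto
  ultimately show ?thesis using k \<open>k \<noteq> 0\<close> \<open>0 < j\<close> by (intro exI[of _ "int k"]) auto
qed

text \<open>A hole that meets \<open>A\<close> and leaves \<open>A \<union> N\<close> crosses
  \<open>N\<close> on both ways around. A vertex of \<open>A\<close> and one outside
  \<open>A \<union> N\<close> separate the two crossings on the cycle, so they are not consecutive,
  although \<open>N\<close> is a clique.\<close>

lemma hole_clique_separator:
  assumes "hole E n f" "f i0 \<in> A"
    and out: "\<And>a b. a \<in> A \<Longrightarrow> (a, b) \<in> E \<Longrightarrow> b \<in> A \<union> N"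
    and clique: "\<And>x y. x \<in> N \<Longrightarrow> y \<in> N \<Longrightarrow> x \<noteq> y \<Longrightarrow> (x, y) \<in> E"
  shows "f i \<in> A \<union> N"
proof (rule ccontr)
  assume fi: "f i \<notin> A \<union> N"
  define g where "g i = f (i + i0)" for i
  define j where "j = (i - i0) mod n"
  have g: "hole E n g" unfolding g_def using assms(1) by (rule hole_shift)
  have n: "4 \<le> n" using g by (simp add: hole_def)
  have g0: "g 0 \<in> A" using assms by (simp add: g_def)
  have gj: "g j \<notin> A \<union> N" using fi hole_mod[OF g, of "i - i0"] by (simp add: j_def g_def)
  have "0 \<le> j" "j < n" using n by (auto simp: j_def)
  moreover have "j \<noteq> 0" using g0 gj by auto
  ultimately have j: "0 < j" "j < n" by auto
  obtain s where s: "0 < s" "s < j" "g s \<in> N" using hole_crosses[OF g g0 gj j(1)] out by blast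
  \<comment> \<open>Going down from \<open>0\<close>, the vertex \<open>g j\<close> reappears at
    index \<open>j - n\<close>; reflection reduces this to the upward case.\<close>
  have "g (- (n - j)) \<notin> A \<union> N" using hole_mod[OF g, of "j - n"] j gj by simp
  then have "\<exists>t. 0 < t \<and> t < n - j \<and> g (- t) \<in> N"
    by (intro hole_crosses[OF hole_reflect[OF g]]) (use g0 j out in auto)
  then obtain t where t: "0 < t" "t < n - j" "g (- t) \<in> N" by blast
  have "g (- t) = g (n - t)" using hole_mod[OF g, of "- t"] t j by (simp add: zmod_zminus1_eq_if)
  then have "g (n - t) \<in> N" using t by simp
  moreover have "g s \<noteq> g (n - t)"
    using inj_on_eq_iff[OF hole_inj_on[OF g], of s "n - t"] s t by auto
  ultimately have "(g s, g (n - t)) \<in> E" using clique s by blast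
  then show False using hole_adj(1)[OF g, of s "n - t"] s t by auto
qed

text \<open>For \<open>j\<close> at least 3, the path from \<open>f 0\<close> to \<open>f j\<close>
  closed by the edge \<open>uv\<close> is a hole of \<open>E\<close>. The values \<open>1\<close>
  and \<open>n - 1\<close> are impossible, as \<open>u\<close> and \<open>v\<close> are not adjacent
  after the deletion.\<close>

lemma hole_minus_edge_chord:
  assumes no_hole: "\<And>n f. \<not> hole E n f" and "sym E" and irr: "\<And>x. (x, x) \<notin> E" and uv: "(u, v) \<in> E"
    and f: "hole (E - {(u, v), (v, u)}) n f" "f 0 = u" "f j = v" "0 < j" "j < n"
  shows "j = 2"
proof (rule ccontr)
  assume "j \<noteq> 2"
  note adj = hole_adj(1)[OF f(1)] and inj = hole_inj_on[OF f(1)]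
  have "j \<noteq> 1" "j \<noteq> n - 1" using adj[of 0 j] f by auto
  then have j: "3 \<le> j" "j < n - 1" using \<open>j \<noteq> 2\<close> f by auto
  have "hole E (j + 1) (\<lambda>i. f (i mod (j + 1)))"
  proof (rule holeI)
    show "inj_on f {0..<j + 1}" by (rule inj_on_subset[OF inj]) (use j in auto)
    fix a b :: int assume ab: "0 \<le> a" "a < b" "b < j + 1"
    have eq: "f x = f y \<longleftrightarrow> x = y" if "0 \<le> x" "x < n" "0 \<le> y" "y < n" for x y
      using inj that by (auto simp: inj_on_def)
    have "(f a, f b) = (u, v) \<longleftrightarrow> a = 0 \<and> b = j" "(f a, f b) \<noteq> (v, u)"
      using eq[of a 0] eq[of b j] eq[of a j] eq[of b 0] ab j f by auto
    then show "(f a, f b) \<in> E \<longleftrightarrow> b = a + 1 \<or> (a = 0 \<and> b = j + 1 - 1)"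
      using adj[of a b] ab j uv by auto
  qed (use j irr \<open>sym E\<close> in auto)
  then show False using no_hole by blast
qed

text \<open>The hole contains both \<open>u\<close> and \<open>v\<close>, as otherwise it would be a
  hole of \<open>E\<close>. By \<open>hole_minus_edge_chord\<close> their distance is two both ways
  around, so it is a 4-cycle \<open>u, a, v, b\<close>.\<close>

lemma hole_minus_edge_square:
  assumes no_hole: "\<And>n f. \<not> hole E n f" and "sym E" and irr: "\<And>x. (x, x) \<notin> E" and uv: "(u, v) \<in> E"
    and f: "hole (E - {(u, v), (v, u)}) n f"
  obtains a b where "{(u, a), (v, a), (u, b), (v, b)} \<subseteq> E" "a \<noteq> b" "(a, b) \<notin> E"
proof -
  have "\<exists>i j. f i = u \<and> f j = v"
  proof (rule ccontr)
    assume "\<nexists>i j. f i = u \<and> f j = v"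
    then have "hole E n f" using f by (auto simp: hole_def)
    then show False using no_hole by blast
  qed
  then obtain i j where ij: "f i = u" "f j = v" by blast
  define g where "g k = f (k + i)" for k
  define m where "m = (j - i) mod n"
  have g: "hole (E - {(u, v), (v, u)}) n g" unfolding g_def using f by (rule hole_shift)
  have n: "4 \<le> n" using g by (simp add: hole_def)
  have g0: "g 0 = u" using ij by (simp add: g_def)
  have gm: "g m = v" using ij hole_mod[OF g, of "j - i"] by (simp add: m_def g_def)
  have "u \<noteq> v" using uv irr by auto
  then have "m \<noteq> 0" using g0 gm by auto
  moreover have "0 \<le> m" "m < n" using n by (auto simp: m_def)
  ultimately have m: "0 < m" "m < n" by auto
  have "m = 2" using hole_minus_edge_chord[OF no_hole \<open>sym E\<close> irr uv g g0 gm m] .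
  have "g (- (n - m)) = v" using hole_mod[OF g, of "m - n"] m gm by simp
  then have "n - m = 2"
    using hole_minus_edge_chord[OF no_hole \<open>sym E\<close> irr uv hole_reflect[OF g], of "n - m"] m g0 by simp
  then have "n = 4" using \<open>m = 2\<close> by simp
  note adj = hole_adj[OF g]
  have "(u, g 1) \<in> E" "(v, g 1) \<in> E" "(u, g 3) \<in> E" "(v, g 3) \<in> E"
    using adj(1)[of 0 1] adj(2)[of 1 2] adj(1)[of 0 3] adj(1)[of 2 3] g0 gm \<open>m = 2\<close> \<open>n = 4\<close> by auto
  moreover have "g 1 \<noteq> g 3" "g 1 \<noteq> g 0" "g 1 \<noteq> g 2"
    using inj_on_eq_iff[OF hole_inj_on[OF g], of 1] \<open>n = 4\<close> by auto
  moreover from this have "(g 1, g 3) \<notin> E" using adj(1)[of 1 3] \<open>n = 4\<close> g0 gm \<open>m = 2\<close> by auto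
  ultimately show ?thesis using that[of "g 1" "g 3"] by simp
qed

section \<open>Minimal triangulations and the components outside a clique\<close>

lemma pair_graph_add_edges:
  assumes "pair_graph G" "F \<subseteq> nonedges G" "sym F"
  shows "pair_graph (add_edges G F)"
proof -
  interpret pair_graph G by fact
  have "finite (pverts G \<times> pverts G)" using pair_finite_verts by simp
  then have "finite F" by (rule finite_subset[rotated]) (use assms in \<open>auto simp: nonedges_def\<close>)
  moreover have "sym (parcs G \<union> F)" using assms arcs_symmetric by (auto simp: sym_def)
  ultimately show ?thesis
    using assms(2) pair_finite_verts pair_finite_arcs no_loops'
    by unfold_locales
      (auto simp: add_edges_def nonedges_def symmetric_def dest: in_arcsD1 in_arcsD2)
qed

lemma triangulation_iff:
  assumes "pair_graph G"
  shows "triangulation G F \<longleftrightarrow> F \<subseteq> nonedges G \<and> sym F \<and> (\<forall>n f. \<not> hole (parcs G \<union> F) n f)"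
  using chordal_iff_no_hole[OF pair_graph_add_edges[OF assms]]
  by (auto simp: triangulation_def add_edges_def)

lemma minimal_triangulation_hole:
  assumes "pair_graph G" "minimal_triangulation G F" "F' \<subset> F" "sym F'"
  obtains n f where "hole (parcs G \<union> F') n f"
proof -
  have "F' \<subseteq> nonedges G"
    using assms by (auto simp: minimal_triangulation_def triangulation_def)
  moreover have "\<not> triangulation G F'"
    using assms by (auto simp: minimal_triangulation_def)
  ultimately show ?thesis using that \<open>sym F'\<close> triangulation_iff[OF assms(1)] by blast
qed

text \<open>\<open>N\<close> lies in \<open>X\<close> and stays a clique when the pairs in
  \<open>Q\<close> are deleted, since these have an end in \<open>C\<close>. A hole of the smaller
  graph that meets \<open>C\<close> thus stays in \<open>C \<union> N\<close>; so no deleted pair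
  joins two vertices of a hole, and the hole was present before the deletion.\<close>

lemma minimal_triangulation_edge_at_component:
  assumes G: "pair_graph G" and F: "minimal_triangulation G F" and X: "clique (add_edges G F) X"
    and C: "C \<in> components (parcs G) (pverts G - X)"
    and ab: "a \<in> C" "(a, b) \<in> parcs G \<union> F"
  shows "b \<in> C \<union> parcs G `` C"
proof (rule ccontr)
  assume b: "b \<notin> C \<union> parcs G `` C"
  interpret pair_graph G by fact
  let ?E = "parcs G"
  define N where "N = ?E `` C - C"
  define Q where "Q = C \<times> - (C \<union> N)"
  define F' where "F' = F - (Q \<union> Q\<inverse>)"
  have tri: "F \<subseteq> nonedges G" "sym F" "\<And>n f. \<not> hole (?E \<union> F) n f"
    using F triangulation_iff[OF G] by (auto simp: minimal_triangulation_def)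
  have "(a, b) \<in> F" "(a, b) \<in> Q" using ab b by (auto simp: Q_def N_def)
  then have "F' \<subset> F" by (auto simp: F'_def)
  moreover have "sym F'" using tri(2) by (auto simp: F'_def sym_def)
  ultimately obtain n f where f: "hole (?E \<union> F') n f"
    using minimal_triangulation_hole[OF G F] by blast
  have N: "N \<subseteq> X" using component_closed[OF C] in_arcsD2 by (auto simp: N_def)
  have CX: "C \<inter> X = {}" using component_subset[OF C] by auto
  have out: "y \<in> C \<union> N" if "x \<in> C" "(x, y) \<in> ?E \<union> F'" for x y
    using that by (auto simp: N_def F'_def Q_def)
  have cl: "(x, y) \<in> ?E \<union> F'" if "x \<in> N" "y \<in> N" "x \<noteq> y" for x y
  proof -
    have "x \<in> X" "y \<in> X" using that N by auto
    then show ?thesis using that X CX by (auto simp: clique_def add_edges_def F'_def Q_def)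
  qed
  have "f i \<in> C \<union> N" if "f i0 \<in> C" for i0 i
    by (rule hole_clique_separator[OF f that]) (use out cl in auto)
  then have "(f i, f j) \<notin> Q \<union> Q\<inverse>" for i j by (auto simp: Q_def)
  then have "hole (?E \<union> F) n f" using f by (auto simp: hole_def F'_def)
  then show False using tri(3) by blast
qed

lemma minimal_triangulation_clique_pair:
  assumes G: "pair_graph G" and F: "minimal_triangulation G F" and X: "clique (add_edges G F) X"
    and uv: "u \<in> X" "v \<in> X" "u \<noteq> v" "(u, v) \<notin> parcs G"
  shows "\<exists>C \<in> components (parcs G) (pverts G - X). {u, v} \<subseteq> parcs G `` C"
proof -
  interpret pair_graph G by fact
  let ?E = "parcs G"
  have tri: "F \<subseteq> nonedges G" "sym F" "\<And>n f. \<not> hole (?E \<union> F) n f"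
    using F triangulation_iff[OF G] by (auto simp: minimal_triangulation_def)
  have H: "sym (?E \<union> F)" "(x, x) \<notin> ?E \<union> F" for x
    using arcs_symmetric no_loops' tri by (auto simp: sym_def nonedges_def)
  have "(u, v) \<in> F" using X uv by (auto simp: clique_def add_edges_def)
  then have uvF: "(u, v) \<in> F" "(v, u) \<in> F" using tri(2) by (auto dest: symD)
  define F' where "F' = F - {(u, v), (v, u)}"
  have "F' \<subset> F" "sym F'" using uvF tri(2) by (auto simp: F'_def sym_def)
  then obtain n f where "hole (?E \<union> F') n f"
    using minimal_triangulation_hole[OF G F] by blast
  moreover have "?E \<union> F' = (?E \<union> F) - {(u, v), (v, u)}"
    using uv arcs_symmetric by (auto simp: F'_def)
  ultimately obtain a b where ab: "{(u, a), (v, a), (u, b), (v, b)} \<subseteq> ?E \<union> F" "a \<noteq> b"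
    "(a, b) \<notin> ?E \<union> F"
    using hole_minus_edge_square[OF tri(3) H(1) H(2), of u v n f] uvF by auto
  \<comment> \<open>Two vertices that are not adjacent cannot both be in the clique;
    \<open>c\<close> is whichever of \<open>a\<close>, \<open>b\<close> lies outside
    \<open>X\<close>.\<close>
  then have "\<not> (a \<in> X \<and> b \<in> X)" using X by (auto simp: clique_def add_edges_def)
  then obtain c where c: "c \<notin> X" "(c, u) \<in> ?E \<union> F" "(c, v) \<in> ?E \<union> F"
    using ab H(1) by (metis insert_subset symD)
  then have "c \<in> pverts G - X" using in_arcsD1 tri(1) by (auto simp: nonedges_def)
  then obtain C where C: "C \<in> components ?E (pverts G - X)" "c \<in> C"
    by (auto simp: components_def)
  have "{u, v} \<subseteq> C \<union> ?E `` C"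
    using minimal_triangulation_edge_at_component[OF G F X C] c by blast
  then show ?thesis using component_subset[OF C(1)] uv C(1) by blast
qed

lemma maximal_clique_not_full_component:
  assumes G: "pair_graph G" and F: "triangulation G F" and X: "maximal_clique (add_edges G F) X"
    and C: "C \<in> components (parcs G) (pverts G - X)"
  shows "\<not> X \<subseteq> parcs G `` C"
proof
  assume full: "X \<subseteq> parcs G `` C"
  interpret pair_graph G by fact
  let ?E = "parcs G"
  have tri: "F \<subseteq> nonedges G" "sym F" "\<And>n f. \<not> hole (?E \<union> F) n f"
    using F triangulation_iff[OF G] by auto
  have H: "sym (?E \<union> F)" "(x, x) \<notin> ?E \<union> F" for x
    using arcs_symmetric no_loops' tri by (auto simp: sym_def nonedges_def)
  have cl: "X \<subseteq> pverts G" "\<And>x y. x \<in> X \<Longrightarrow> y \<in> X \<Longrightarrow> x \<noteq> y \<Longrightarrow> (x, y) \<in> ?E \<union> F"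
    using X by (auto simp: maximal_clique_def clique_def add_edges_def)
  have "sym ?E" using arcs_symmetric by (auto intro: symI)
  \<comment> \<open>\<open>C\<close> is connected in \<open>G\<close>, hence also in the
    triangulation, where the common neighbour is sought.\<close>
  then have conn: "(a, b) \<in> rtrancl_on C (?E \<union> F)" if "a \<in> C" "b \<in> C" for a b
    using component_connected[OF _ C that] by (auto intro: rtrancl_on_mono[rotated 2])
  have sub: "C \<subseteq> pverts G" "C \<inter> X = {}" using component_subset[OF C] by auto
  have "finite X" using cl(1) pair_finite_verts by (rule finite_subset)
  then obtain c where c: "c \<in> C" "\<And>x. x \<in> X \<Longrightarrow> (c, x) \<in> ?E \<union> F"
    by (rule ex_common_neighbour_of_clique[OF tri(3) H(1) H(2), of X C])
      (use cl(2) conn component_nonempty[OF C] sub(2) full in auto)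
  have "clique (add_edges G F) (insert c X)"
    using c sub cl symD[OF H(1)] by (auto simp: clique_def add_edges_def)
  moreover have "X \<subset> insert c X" using c sub by auto
  ultimately show False using X by (auto simp: maximal_clique_def)
qed

theorem theorem3p8:
  fixes G :: "'a pair_pre_digraph" and X :: "'a set"
  assumes "pair_graph G"
    and "X \<subseteq> pverts G"
    and "potential_maximal_clique G X"
  shows "clique G X \<or>
    (\<exists>S T. minimal_separator G S \<and> minimal_separator G T \<and> S \<noteq> T \<and> X \<subseteq> S \<union> T)"
proof (cases "clique G X")
  case False
  obtain F where F: "minimal_triangulation G F" "maximal_clique (add_edges G F) X"
    using assms(3) by (auto simp: potential_maximal_clique_def)
  have tri: "triangulation G F" using F(1) by (simp add: minimal_triangulation_def)
  have X: "clique (add_edges G F) X" using F(2) by (simp add: maximal_clique_def)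
  have "\<exists>S T. minimal_separator G S \<and> minimal_separator G T \<and> S \<noteq> T \<and> X \<subseteq> S \<union> T"
    using assms(1,2) False maximal_clique_not_full_component[OF assms(1) tri F(2)]
      minimal_triangulation_clique_pair[OF assms(1) F(1) X]
    by (rule minimal_separators_of_cover)
  then show ?thesis ..
qed simp

end
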